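(* There exists a family of streaming stochastic multi-armed bandit instances such that for any parameters $T$ and $K$ with $T\geq K$, every single-pass streaming algorithm with a memory of $\frac{K}{20}$ arms suffers total expected regret \[\mathbb{E}[R_T]\geq C\cdot K^{1/3}\cdot T^{2/3}\] for some (absolute) constant $C>0$. Furthermore, the lower bound holds even when the order of arrival of the arms is uniformly at random.
   Context: Single-pass streaming multi-armed bandits: there are $K$ arms, each with an unknown reward distribution (supported on $[0,1]$) with mean $\mu_i$; $\mu^*=\max_i\mu_i$. The arms arrive one by one in a stream (in an adversarially chosen order unless stated otherwise). The algorithm may only pull arms currently stored in its memory (including the arm currently being read); once an arm is not stored or is discarded from memory, it can never be retrieved again. A memory of $m$ arms means at most $m$ arms are stored at any time. The algorithm performs a total of $T$ arm pulls (trials). If $a_1,\dots,a_T$ are the arms pulled, the regret is $R_T=T\mu^*-\sum_{s=1}^T\mu_{a_s}$, and the expected regret is its expectation over the randomness of the rewards, the algorithm, and the instance. *)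

theory Defs
  imports "HOL-Probability.Probability" "HOL-Combinatorics.Permutations"
begin

text \<open>Single-pass streaming stochastic multi-armed bandits.

An instance with K arms is given in stream order: arm_dist i is the reward
distribution of the i-th arm to arrive (positions 0..K-1).  The algorithm refers
to arms by their arrival position; it never learns anything else about them.\<close>

type_synonym bandit_inst = "nat \<Rightarrow> real pmf"

definition arm_mean :: "real pmf \<Rightarrow> real" where
  "arm_mean p = measure_pmf.expectation p (\<lambda>x. x)"

definition best_mean :: "nat \<Rightarrow> bandit_inst \<Rightarrow> real" where
  "best_mean K a = Max ((\<lambda>i. arm_mean (a i)) ` {..<K})"

definition valid_instance :: "nat \<Rightarrow> bandit_inst \<Rightarrow> bool" where
  "valid_instance K a \<longleftrightarrow> (\<forall>i<K. set_pmf (a i) \<subseteq> {0..1})"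

text \<open>Decisions of the algorithm: pull a stored arm (given by its stream position),
or read the next arm of the stream, keeping only the stored arms in the given set
(the others are discarded forever); the newly read arm is then stored as well.\<close>

datatype decision = Pull nat | Read "nat set"

definition legal_decision :: "nat \<Rightarrow> nat \<Rightarrow> nat \<Rightarrow> nat set \<Rightarrow> decision \<Rightarrow> bool" where
  "legal_decision m K j M d =
     (case d of Pull i \<Rightarrow> i \<in> M
              | Read M' \<Rightarrow> j < K \<and> M' \<subseteq> M \<and> card M' + 1 \<le> m)"

text \<open>A (randomised) streaming algorithm with internal state of type 's:
an initial state, a randomised decision rule (depending on its state, the number of
arms read, the stored arms, and the number of pulls so far), and a state update
after observing the outcome (the reward for a pull; 0 for a read).
The internal state is unrestricted (statistics may be kept); only stored arms count.\<close>

type_synonym 's algorithm =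
  "'s \<times> ('s \<Rightarrow> nat \<Rightarrow> nat set \<Rightarrow> nat \<Rightarrow> decision pmf) \<times> ('s \<Rightarrow> decision \<Rightarrow> real \<Rightarrow> 's)"

definition admissible_config :: "nat \<Rightarrow> nat \<Rightarrow> nat \<Rightarrow> nat set \<Rightarrow> bool" where
  "admissible_config m K j M \<longleftrightarrow>
     j \<le> K \<and> M \<subseteq> {..<j} \<and> card M \<le> m \<and> (j > 0 \<longrightarrow> M \<noteq> {})"

definition streaming_alg :: "nat \<Rightarrow> nat \<Rightarrow> 's algorithm \<Rightarrow> bool" where
  "streaming_alg m K A \<longleftrightarrow>
     (\<forall>s j M t. admissible_config m K j M \<longrightarrow>
        (\<forall>d \<in> set_pmf (fst (snd A) s j M t). legal_decision m K j M d))"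

text \<open>Configuration: (algorithm state, #arms read, stored arms, #pulls, accumulated regret).\<close>

type_synonym 's config = "'s \<times> nat \<times> nat set \<times> nat \<times> real"

definition step :: "nat \<Rightarrow> nat \<Rightarrow> bandit_inst \<Rightarrow> 's algorithm \<Rightarrow> 's config \<Rightarrow> 's config pmf" where
  "step K T a A c = (case c of (s, j, M, t, r) \<Rightarrow>
     if T \<le> t then return_pmf c else
     bind_pmf (fst (snd A) s j M t) (\<lambda>d. case d of
        Pull i \<Rightarrow> map_pmf (\<lambda>x. (snd (snd A) s d x, j, M, Suc t,
                                   r + (best_mean K a - arm_mean (a i)))) (a i)
      | Read M' \<Rightarrow> return_pmf (snd (snd A) s d 0, Suc j, insert j M', t, r)))"

text \<open>Each step either pulls (at most T times) or reads (at most K times), so after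
T + K steps exactly T pulls have been made.\<close>

definition run :: "nat \<Rightarrow> nat \<Rightarrow> bandit_inst \<Rightarrow> 's algorithm \<Rightarrow> 's config pmf" where
  "run K T a A = ((\<lambda>p. bind_pmf p (step K T a A)) ^^ (T + K))
                    (return_pmf (fst A, 0, {}, 0, 0))"

definition expected_regret :: "nat \<Rightarrow> nat \<Rightarrow> bandit_inst \<Rightarrow> 's algorithm \<Rightarrow> real" where
  "expected_regret K T a A =
     measure_pmf.expectation (run K T a A) (\<lambda>c. snd (snd (snd (snd c))))"

definition avg_regret :: "nat \<Rightarrow> nat \<Rightarrow> bandit_inst pmf \<Rightarrow> 's algorithm \<Rightarrow> real" where
  "avg_regret K T D A = measure_pmf.expectation D (\<lambda>a. expected_regret K T a A)"

definition random_order :: "nat \<Rightarrow> bandit_inst pmf \<Rightarrow> bandit_inst pmf" where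
  "random_order K D = bind_pmf D (\<lambda>a.
      map_pmf (\<lambda>\<sigma>. a \<circ> \<sigma>) (pmf_of_set {\<sigma>. \<sigma> permutes {..<K}}))"

end

theory Submission
  imports Defs
begin

text \<open>All arms are fair coins except one at a uniformly random position \<open>i\<close>, whose mean is \<open>1\<close> or
  \<open>1/2 + b\<close> with equal probability, where \<open>b = (K/T) powr (1/3) / 8\<close>. This distribution is invariant under
  permutations of the stream, so both claims are about the same average.

  Let \<open>X\<close> be the expected number of pulls during the first half of the stream when all arms are
  fair. If the arm of mean \<open>1\<close> comes in the second half, each of these pulls costs \<open>1/2\<close>. If the
  arm of mean \<open>1/2 + b\<close> comes in the first half, then either it is discarded after at most \<open>T/2\<close>
  pulls, and the regret is at least \<open>b T / 2\<close>, or it is still stored after the first half or more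
  than \<open>T/2\<close> pulls have been spent there. On fair coins the latter event has probability at most about \<open>1/10 + 2 X / T\<close> on average over \<open>i\<close>, since only \<open>K/20\<close> arms are
  stored; a change of measure transfers this to the true instance at a price proportional to \<open>b\<^sup>2\<close>
  times the number of pulls of arm \<open>i\<close>, which sums to \<open>b\<^sup>2 X\<close> over \<open>i\<close>. With the above \<open>b\<close> the gain
  from \<open>X\<close> in the first case outweighs its loss in the second, leaving a regret of order \<open>b T\<close>.\<close>

section \<open>Expectations of functions bounded on the support\<close>

lemma integrable_pmf_bounded:
  fixes f :: "'a \<Rightarrow> real"
  assumes "\<And>x. x \<in> set_pmf p \<Longrightarrow> \<bar>f x\<bar> \<le> B"
  shows "integrable (measure_pmf p) f"
  by (rule measure_pmf.integrable_const_bound[where B = B])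
     (use assms in \<open>auto simp: AE_measure_pmf_iff\<close>)

lemma abs_expectation_pmf_le:
  fixes f :: "'a \<Rightarrow> real"
  assumes "\<And>x. x \<in> set_pmf p \<Longrightarrow> \<bar>f x\<bar> \<le> B"
  shows "\<bar>measure_pmf.expectation p f\<bar> \<le> B"
proof -
  have i: "integrable (measure_pmf p) f" by (rule integrable_pmf_bounded[OF assms])
  have "AE x in measure_pmf p. f x \<le> B" "AE x in measure_pmf p. - B \<le> f x"
    using assms by (auto simp: AE_measure_pmf_iff abs_le_iff) (metis minus_le_iff)
  then show ?thesis
    using measure_pmf.integral_le_const[OF i] measure_pmf.integral_ge_const[OF i]
    by (auto simp: abs_le_iff) (metis minus_le_iff)
qed

text \<open>Accumulated regret is unbounded over all configurations but bounded over the reachable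
  ones, so the bound is asked on the support only. Truncating \<open>f\<close> at \<open>B\<close>
  changes it on a null set and makes Fubini applicable.\<close>

lemma expectation_bind_pmf:
  fixes f :: "'b \<Rightarrow> real"
  assumes "\<And>x y. x \<in> set_pmf p \<Longrightarrow> y \<in> set_pmf (q x) \<Longrightarrow> \<bar>f y\<bar> \<le> B"
  shows "measure_pmf.expectation (bind_pmf p q) f =
           measure_pmf.expectation p (\<lambda>x. measure_pmf.expectation (q x) f)"
proof -
  define g where "g = (\<lambda>y. max (- B) (min B (f y)))"
  obtain x0 y0 where "x0 \<in> set_pmf p" "y0 \<in> set_pmf (q x0)"
    using set_pmf_not_empty by (meson ex_in_conv)
  then have "0 \<le> B" using assms[of x0 y0] by linarith
  then have bg: "\<bar>g y\<bar> \<le> B" for y by (auto simp: g_def)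
  have fg: "f y = g y" if "x \<in> set_pmf p" "y \<in> set_pmf (q x)" for x y
    using assms[OF that] by (auto simp: g_def)
  have "measure_pmf.expectation (bind_pmf p q) f = measure_pmf.expectation (bind_pmf p q) g"
    by (rule integral_cong_AE) (auto simp: AE_measure_pmf_iff fg)
  also have "\<dots> = measure_pmf.expectation p (\<lambda>x. measure_pmf.expectation (q x) g)"
    unfolding measure_pmf_bind
    by (rule integral_bind[where K = "count_space UNIV" and B' = 1 and B = B])
       (use bg in \<open>auto simp: measurable_def space_subprob_algebra
          measure_pmf.emeasure_space_1 measure_pmf.emeasure_le_1
          prob_space_imp_subprob_space measure_pmf.prob_space_axioms\<close>)
  also have "\<dots> = measure_pmf.expectation p (\<lambda>x. measure_pmf.expectation (q x) f)"
    by (intro integral_cong_AE) (auto simp: AE_measure_pmf_iff fg intro!: integral_cong_AE)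
  finally show ?thesis .
qed

section \<open>Values of stopped runs\<close>

abbreviation decide :: "'s algorithm \<Rightarrow> 's \<Rightarrow> nat \<Rightarrow> nat set \<Rightarrow> nat \<Rightarrow> decision pmf" where
  "decide A \<equiv> fst (snd A)"

abbreviation update :: "'s algorithm \<Rightarrow> 's \<Rightarrow> decision \<Rightarrow> real \<Rightarrow> 's" where
  "update A \<equiv> snd (snd A)"

text \<open>One Bellman step, with \<open>V\<close> as the continuation value. Reading is
  free.\<close>

definition after :: "'s algorithm \<Rightarrow> bandit_inst \<Rightarrow> (nat \<Rightarrow> real) \<Rightarrow>
    ('s \<Rightarrow> nat \<Rightarrow> nat set \<Rightarrow> nat \<Rightarrow> real) \<Rightarrow> 's \<Rightarrow> nat \<Rightarrow> nat set \<Rightarrow> nat \<Rightarrow> decision \<Rightarrow> real" where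
  "after A a g V s j M t d = (case d of
      Pull k \<Rightarrow> g k + measure_pmf.expectation (a k) (\<lambda>x. V (update A s d x) j M (Suc t))
    | Read M' \<Rightarrow> V (update A s d 0) (Suc j) (insert j M') t)"

text \<open>Expected total cost \<open>g\<close> of the pulls plus terminal reward \<open>f\<close> of a run of at most
  \<open>n\<close> steps that is frozen as soon as \<open>S\<close> holds.\<close>

primrec payoff :: "(nat \<Rightarrow> nat \<Rightarrow> bool) \<Rightarrow> 's algorithm \<Rightarrow> bandit_inst \<Rightarrow> (nat \<Rightarrow> real) \<Rightarrow>
    (nat set \<Rightarrow> nat \<Rightarrow> real) \<Rightarrow> nat \<Rightarrow> 's \<Rightarrow> nat \<Rightarrow> nat set \<Rightarrow> nat \<Rightarrow> real" where
  "payoff S A a g f 0 = (\<lambda>s j M t. f M t)"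
| "payoff S A a g f (Suc n) = (\<lambda>s j M t. if S j t then f M t else
      measure_pmf.expectation (decide A s j M t) (after A a g (payoff S A a g f n) s j M t))"

lemma abs_after_le:
  assumes "\<And>k. \<bar>g k\<bar> \<le> G" "\<And>s j M t. \<bar>V s j M t\<bar> \<le> B"
  shows "\<bar>after A a g V s j M t d\<bar> \<le> B + G"
proof (cases d)
  case (Pull k)
  have "\<bar>measure_pmf.expectation (a k) (\<lambda>x. V (update A s d x) j M (Suc t))\<bar> \<le> B"
    by (rule abs_expectation_pmf_le) (rule assms)
  then show ?thesis using assms(1)[of k] unfolding after_def Pull by simp
next
  case (Read M')
  have "0 \<le> G" using assms(1)[of 0] by linarith
  then show ?thesis using assms(2)[of "update A s d 0" "Suc j" "insert j M'" t]
    unfolding after_def Read by simp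
qed

lemma abs_payoff_le:
  assumes g: "\<And>k. \<bar>g k\<bar> \<le> G" and f: "\<And>M t. \<bar>f M t\<bar> \<le> B"
  shows "\<bar>payoff S A a g f n s j M t\<bar> \<le> B + real n * G"
proof (induction n arbitrary: s j M t)
  case 0
  then show ?case using f by simp
next
  case (Suc n)
  have G: "0 \<le> G" using g[of 0] by linarith
  have "\<bar>measure_pmf.expectation (decide A s j M t)
          (after A a g (payoff S A a g f n) s j M t)\<bar> \<le> B + real n * G + G"
    by (intro abs_expectation_pmf_le abs_after_le g Suc)
  moreover have "\<bar>f M t\<bar> \<le> B + (1 + real n) * G"
    using f[of M t] G by (simp add: add_increasing2)
  ultimately show ?case by (simp add: algebra_simps)
qed

lemma integrable_after_payoff:
  assumes "\<And>k. \<bar>g k\<bar> \<le> G" "\<And>M t. \<bar>f M t\<bar> \<le> B"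
  shows "integrable (measure_pmf p) (after A a g (payoff S A a g f n) s j M t)"
  by (rule integrable_pmf_bounded[OF abs_after_le[OF assms(1) abs_payoff_le[OF assms]]])

lemma payoff_ge_0:
  assumes "\<And>k. 0 \<le> g k" "\<And>M t. 0 \<le> f M t"
  shows "0 \<le> payoff S A a g f n s j M t"
proof (induction n arbitrary: s j M t)
  case (Suc n)
  have "0 \<le> after A a g (payoff S A a g f n) s j M t d" for d
    using assms(1) Suc by (auto simp: after_def split: decision.split
        intro!: add_nonneg_nonneg integral_nonneg_AE)
  then show ?case using assms(2) by (auto intro!: integral_nonneg_AE)
qed (use assms in auto)

text \<open>Runs on fair coins are the same for every planted position, so the sum over positions
  collapses to a single run with summed costs and rewards. The uniform bounds give
  integrability.\<close>

lemma payoff_sum: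
  assumes "finite I" "\<And>i k. i \<in> I \<Longrightarrow> \<bar>g i k\<bar> \<le> G" "\<And>i M t. i \<in> I \<Longrightarrow> \<bar>f i M t\<bar> \<le> B"
  shows "(\<Sum>i\<in>I. payoff S A a (g i) (f i) n s j M t) =
           payoff S A a (\<lambda>k. \<Sum>i\<in>I. g i k) (\<lambda>M t. \<Sum>i\<in>I. f i M t) n s j M t"
proof (induction n arbitrary: s j M t)
  case (Suc n)
  let ?V = "\<lambda>i. payoff S A a (g i) (f i) n"
  have bV: "\<bar>?V i s j M t\<bar> \<le> B + real n * G" if "i \<in> I" for i s j M t
    by (intro abs_payoff_le assms that)
  have "(\<Sum>i\<in>I. after A a (g i) (?V i) s j M t d) = after A a (\<lambda>k. \<Sum>i\<in>I. g i k)
      (payoff S A a (\<lambda>k. \<Sum>i\<in>I. g i k) (\<lambda>M t. \<Sum>i\<in>I. f i M t) n) s j M t d" for d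
  proof (cases d)
    case (Pull k)
    have "(\<Sum>i\<in>I. measure_pmf.expectation (a k) (\<lambda>x. ?V i (update A s d x) j M (Suc t))) =
       measure_pmf.expectation (a k) (\<lambda>x. \<Sum>i\<in>I. ?V i (update A s d x) j M (Suc t))"
      by (rule Bochner_Integration.integral_sum[symmetric])
         (rule integrable_pmf_bounded, rule bV)
    then show ?thesis by (simp add: after_def Pull Suc sum.distrib)
  qed (simp add: after_def Suc)
  moreover have "(\<Sum>i\<in>I. measure_pmf.expectation (decide A s j M t) (after A a (g i) (?V i) s j M t))
      = measure_pmf.expectation (decide A s j M t) (\<lambda>d. \<Sum>i\<in>I. after A a (g i) (?V i) s j M t d)"
    by (rule Bochner_Integration.integral_sum[symmetric])
       (rule integrable_after_payoff[where G = G and B = B]; use assms in auto)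
  ultimately show ?case by simp
qed simp

text \<open>The induction step shared by most comparisons of two runs below: both make the same
  decision, so an affine inequality for each possible decision survives averaging, even if stopping
  rule, instance and costs differ.\<close>

lemma expectation_after_le:
  assumes g: "\<And>k. \<bar>g k\<bar> \<le> G" "\<And>M t. \<bar>f M t\<bar> \<le> B"
    and g': "\<And>k. \<bar>g' k\<bar> \<le> G'" "\<And>M t. \<bar>f' M t\<bar> \<le> B'"
    and le: "\<And>d. d \<in> set_pmf p \<Longrightarrow>
      after A a g (payoff S A a g f n) s j M t d
        \<le> u * after A a' g' (payoff S' A a' g' f' n) s j M t d + v"
  shows "measure_pmf.expectation p (after A a g (payoff S A a g f n) s j M t)
    \<le> u * measure_pmf.expectation p (after A a' g' (payoff S' A a' g' f' n) s j M t) + v"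
proof -
  have i: "integrable (measure_pmf p) (after A a' g' (payoff S' A a' g' f' n) s j M t)"
    by (rule integrable_after_payoff[OF g'])
  have "measure_pmf.expectation p (after A a g (payoff S A a g f n) s j M t)
    \<le> measure_pmf.expectation p (\<lambda>d. u * after A a' g' (payoff S' A a' g' f' n) s j M t d + v)"
    by (intro integral_mono_AE integrable_after_payoff[OF g])
       (use i le in \<open>auto simp: AE_measure_pmf_iff\<close>)
  then show ?thesis using i by simp
qed

section \<open>The regret as a payoff\<close>

definition iterate :: "nat \<Rightarrow> nat \<Rightarrow> bandit_inst \<Rightarrow> 's algorithm \<Rightarrow> nat \<Rightarrow> 's config \<Rightarrow> 's config pmf" where
  "iterate K T a A n c = ((\<lambda>p. bind_pmf p (step K T a A)) ^^ n) (return_pmf c)"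

lemma iterate_0: "iterate K T a A 0 c = return_pmf c"
  by (simp add: iterate_def)

text \<open>The iteration in \<open>run\<close> appends steps at the end, while
  \<open>payoff\<close> unfolds the first step; associativity of bind reconciles the two.\<close>

lemma iterate_Suc:
  "iterate K T a A (Suc n) c = bind_pmf (step K T a A c) (iterate K T a A n)"
proof -
  have "((\<lambda>p. bind_pmf p q) ^^ n) p = bind_pmf p (\<lambda>c. ((\<lambda>p. bind_pmf p q) ^^ n) (return_pmf c))"
    for q :: "'a config \<Rightarrow> 'a config pmf" and p
    by (induction n) (simp_all add: bind_return_pmf' bind_assoc_pmf)
  then show ?thesis unfolding iterate_def funpow_Suc_right comp_def bind_return_pmf .
qed

text \<open>Supplies the support bound required by \<open>expectation_bind_pmf\<close>: each step
  moves the regret by at most \<open>G\<close>.\<close>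

lemma iterate_regret_bound:
  assumes "\<And>k. \<bar>best_mean K a - arm_mean (a k)\<bar> \<le> G"
    and "(s', j', M', t', r') \<in> set_pmf (iterate K T a A n (s, j, M, t, r))"
  shows "\<bar>r'\<bar> \<le> \<bar>r\<bar> + real n * G"
  using assms(2)
proof (induction n arbitrary: s j M t r)
  case 0
  then show ?case by (simp add: iterate_0)
next
  case (Suc n)
  have G: "0 \<le> G" using assms(1)[of 0] by linarith
  from Suc.prems obtain s1 j1 M1 t1 r1 where 1: "(s1, j1, M1, t1, r1) \<in> set_pmf (step K T a A (s, j, M, t, r))"
    and 2: "(s', j', M', t', r') \<in> set_pmf (iterate K T a A n (s1, j1, M1, t1, r1))"
    by (auto simp: iterate_Suc)
  from 1 have "r1 = r \<or> (\<exists>k. r1 = r + (best_mean K a - arm_mean (a k)))"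
  proof (cases "T \<le> t")
    case False
    with 1 obtain d where "(s1, j1, M1, t1, r1) \<in> set_pmf (case d of
        Pull i \<Rightarrow> map_pmf (\<lambda>x. (update A s d x, j, M, Suc t,
                     r + (best_mean K a - arm_mean (a i)))) (a i)
      | Read M' \<Rightarrow> return_pmf (update A s d 0, Suc j, insert j M', t, r))"
      by (auto simp: step_def)
    then show ?thesis by (cases d) auto
  qed (use 1 in \<open>auto simp: step_def\<close>)
  then have "\<bar>r1\<bar> \<le> \<bar>r\<bar> + G"
  proof
    assume "\<exists>k. r1 = r + (best_mean K a - arm_mean (a k))"
    then obtain k where "r1 = r + (best_mean K a - arm_mean (a k))" ..
    with assms(1)[of k] show ?thesis by linarith
  qed (use G in simp)
  with Suc.IH[OF 2] show ?case by (simp add: algebra_simps)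
qed

text \<open>The regret \<open>r\<close> so far enters every outcome additively and splits off;
  conditioning on the first step shows that the remainder obeys the recursion of
  \<open>payoff\<close>.\<close>

lemma expectation_iterate_regret:
  assumes G: "\<And>k. \<bar>best_mean K a - arm_mean (a k)\<bar> \<le> G"
  shows "measure_pmf.expectation (iterate K T a A n (s, j, M, t, r)) (\<lambda>c. snd (snd (snd (snd c))))
    = r + payoff (\<lambda>j t. T \<le> t) A a (\<lambda>k. best_mean K a - arm_mean (a k)) (\<lambda>M t. 0) n s j M t"
proof (induction n arbitrary: s j M t r)
  case 0
  then show ?case by (simp add: iterate_0)
next
  case (Suc n)
  let ?E = "\<lambda>p. measure_pmf.expectation p (\<lambda>c. snd (snd (snd (snd c))))"
  let ?g = "\<lambda>k. best_mean K a - arm_mean (a k)"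
  let ?P = "payoff (\<lambda>j t. T \<le> t) A a ?g (\<lambda>M t. 0)"
  let ?I = "iterate K T a A n"
  have bnd: "\<bar>snd (snd (snd (snd c')))\<bar> \<le> \<bar>snd (snd (snd (snd c)))\<bar> + real n * G"
    if "c' \<in> set_pmf (?I c)" for c c'
    by (cases c, cases c') (use that iterate_regret_bound[OF G] in fastforce)
  have G0: "0 \<le> G" using G[of 0] by linarith
  show ?case
  proof (cases "T \<le> t")
    case True
    have "?P n s j M t = 0" using True by (cases n) auto
    then show ?thesis using True Suc by (simp add: iterate_Suc step_def bind_return_pmf)
  next
    case False
    \<comment> \<open>The law of the next configuration given the decision, so that a step factors
      into deciding and observing.\<close>
    define nxt where "nxt = (\<lambda>d. case d of
        Pull i \<Rightarrow> map_pmf (\<lambda>x. (update A s d x, j, M, Suc t, r + ?g i)) (a i)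
      | Read M' \<Rightarrow> return_pmf (update A s d 0, Suc j, insert j M', t, r))"
    have nxt_r: "\<bar>snd (snd (snd (snd c)))\<bar> \<le> \<bar>r\<bar> + G" if c: "c \<in> set_pmf (nxt d)" for c d
    proof (cases d)
      case (Pull k)
      have "snd (snd (snd (snd c))) = r + ?g k" using c by (auto simp: nxt_def Pull)
      then show ?thesis using G[of k] by linarith
    qed (use c G0 in \<open>auto simp: nxt_def\<close>)
    have bnd2: "\<bar>snd (snd (snd (snd c')))\<bar> \<le> \<bar>r\<bar> + G + real n * G"
      if "c \<in> set_pmf (nxt d)" "c' \<in> set_pmf (?I c)" for c c' d
      using bnd[OF that(2)] nxt_r[OF that(1)] by linarith
    have int: "integrable (measure_pmf (decide A s j M t)) (after A a ?g (?P n) s j M t)"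
      by (rule integrable_after_payoff[OF G, where B = 0]) simp
    have "iterate K T a A (Suc n) (s, j, M, t, r) =
        bind_pmf (decide A s j M t) (\<lambda>d. bind_pmf (nxt d) ?I)"
      using False by (simp add: iterate_Suc step_def bind_assoc_pmf nxt_def)
    then have "?E (iterate K T a A (Suc n) (s, j, M, t, r)) =
        measure_pmf.expectation (decide A s j M t) (\<lambda>d. ?E (bind_pmf (nxt d) ?I))"
      by (simp only:) (rule expectation_bind_pmf[where B = "\<bar>r\<bar> + G + real n * G"], auto dest: bnd2)
    also have "(\<lambda>d. ?E (bind_pmf (nxt d) ?I)) = (\<lambda>d. r + after A a ?g (?P n) s j M t d)"
    proof
      fix d
      have "?E (bind_pmf (nxt d) ?I) = measure_pmf.expectation (nxt d) (\<lambda>c. ?E (?I c))"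
        by (rule expectation_bind_pmf) (rule bnd2)
      also have "\<dots> = r + after A a ?g (?P n) s j M t d"
      proof (cases d)
        case (Pull k)
        have "integrable (measure_pmf (a k)) (\<lambda>x. ?P n (update A s d x) j M (Suc t))"
          by (rule integrable_pmf_bounded, rule abs_payoff_le[OF G, where B = 0]) simp
        then show ?thesis by (simp add: nxt_def after_def Pull Suc)
      qed (simp add: nxt_def after_def Suc)
      finally show "?E (bind_pmf (nxt d) ?I) = r + after A a ?g (?P n) s j M t d" .
    qed
    also have "measure_pmf.expectation (decide A s j M t) (\<lambda>d. r + after A a ?g (?P n) s j M t d) =
        r + measure_pmf.expectation (decide A s j M t) (after A a ?g (?P n) s j M t)"
      using int by simp
    finally show ?thesis using False by simp
  qed
qed

lemma expected_regret_eq_payoff: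
  assumes "\<And>k. \<bar>best_mean K a - arm_mean (a k)\<bar> \<le> G"
  shows "expected_regret K T a A =
    payoff (\<lambda>j t. T \<le> t) A a (\<lambda>k. best_mean K a - arm_mean (a k)) (\<lambda>M t. 0) (T + K) (fst A) 0 {} 0"
  using expectation_iterate_regret[OF assms, of T A "T + K" "fst A" 0 "{}" 0 0]
  by (simp add: expected_regret_def run_def iterate_def)


lemma payoff_scale:
  "payoff S A a (\<lambda>k. c * g k) (\<lambda>M t. c * f M t) n s j M t = c * payoff S A a g f n s j M t"
proof (induction n arbitrary: s j M t)
  case (Suc n)
  have "after A a (\<lambda>k. c * g k) (payoff S A a (\<lambda>k. c * g k) (\<lambda>M t. c * f M t) n) s j M t
      = (\<lambda>d. c * after A a g (payoff S A a g f n) s j M t d)"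
    by (rule ext) (simp add: after_def Suc distrib_left split: decision.split)
  then show ?case by simp
qed simp

section \<open>Instances with one planted arm\<close>

definition coin :: "real \<Rightarrow> real pmf" where
  "coin p = map_pmf of_bool (bernoulli_pmf p)"

definition planted :: "real \<Rightarrow> nat \<Rightarrow> bandit_inst" where
  "planted p i = (\<lambda>k. coin (if k = i then p else 1/2))"

lemma expectation_coin:
  assumes "0 \<le> p" "p \<le> 1"
  shows "measure_pmf.expectation (coin p) f = p * f 1 + (1 - p) * (f 0 :: real)"
  using assms by (simp add: coin_def mult.commute)

lemma arm_mean_coin: "0 \<le> p \<Longrightarrow> p \<le> 1 \<Longrightarrow> arm_mean (coin p) = p"
  by (simp add: arm_mean_def expectation_coin)

lemma valid_instance_planted: "valid_instance K (planted p i)"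
  by (auto simp: valid_instance_def planted_def coin_def)

lemma best_mean_planted:
  assumes "i < K" "1/2 \<le> p" "p \<le> 1"
  shows "best_mean K (planted p i) = p"
  unfolding best_mean_def
proof (rule Max_eqI)
  show "p \<in> (\<lambda>k. arm_mean (planted p i k)) ` {..<K}"
    using assms by (intro image_eqI[of _ _ i]) (auto simp: planted_def arm_mean_coin)
qed (use assms in \<open>auto simp: planted_def arm_mean_coin\<close>)

lemma expected_regret_planted:
  assumes "i < K" "1/2 \<le> p" "p \<le> 1"
  shows "expected_regret K T (planted p i) A = payoff (\<lambda>j t. T \<le> t) A (planted p i)
           (\<lambda>k. if k = i then 0 else p - 1/2) (\<lambda>M t. 0) (T + K) (fst A) 0 {} 0"
proof -
  have "(\<lambda>k. best_mean K (planted p i) - arm_mean (planted p i k)) = (\<lambda>k. if k = i then 0 else p - 1/2)"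
    unfolding best_mean_planted[OF assms] using assms
    by (auto simp: planted_def arm_mean_coin)
  then show ?thesis
    using expected_regret_eq_payoff[of K "planted p i" 1 T A] assms
    by (simp add: fun_eq_iff)
qed

text \<open>Hellinger-type bound: \<open>1 - u \<le> 2 (1 - sqrt u)\<close> and \<open>(1 - sqrt u)\<^sup>2 \<le> u - 1 - ln u\<close>.\<close>

lemma one_minus_le_entropy:
  fixes u \<delta> :: real
  assumes "0 < u" "0 < \<delta>"
  shows "1 - u \<le> \<delta> + (u - 1 - ln u) / \<delta>"
proof -
  define w where "w = sqrt u"
  have w: "0 < w" "u = w\<^sup>2" using assms by (auto simp: w_def)
  have "ln u = 2 * ln w" using w by (simp add: ln_realpow)
  moreover have "ln w \<le> w - 1" using w by (simp add: ln_le_minus_one)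
  ultimately have "(1 - w)\<^sup>2 \<le> u - 1 - ln u" unfolding w(2)
    by (simp add: power2_eq_square algebra_simps)
  then have "(1 - w)\<^sup>2 / \<delta> \<le> (u - 1 - ln u) / \<delta>" using assms by (simp add: divide_right_mono)
  moreover have "2 * (1 - w) \<le> \<delta> + (1 - w)\<^sup>2 / \<delta>"
  proof -
    have "0 \<le> (\<delta> - (1 - w))\<^sup>2 / \<delta>" using assms by simp
    also have "\<dots> = \<delta> + (1 - w)\<^sup>2 / \<delta> - 2 * (1 - w)"
      using assms by (simp add: field_simps power2_eq_square)
    finally show ?thesis by simp
  qed
  moreover have "1 - u \<le> 2 * (1 - w)"
    using zero_le_power2[of "1 - w"] by (simp add: w power2_eq_square algebra_simps)
  ultimately show ?thesis by linarith
qed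

text \<open>Change of measure: \<open>u\<close> plays the role of the likelihood ratio accumulated so far, and
  \<open>u - 1 - ln u\<close> is a potential whose expected increase per pull of the planted arm is exactly
  the relative entropy between the two coins.\<close>

lemma payoff_change_of_measure:
  assumes F: "\<And>M t. 0 \<le> F M t" "\<And>M t. F M t \<le> 1"
    and b: "0 < b" "b < 1/2" and \<delta>: "0 < \<delta>" and u: "0 < u"
    and \<kappa>: "\<kappa> = - ln (1 - 4 * b\<^sup>2) / (2 * \<delta>)"
  shows "payoff S A (\<lambda>k. coin (1/2)) (\<lambda>k. if k = i then - \<kappa> else 0) F n s j M t
    \<le> u * payoff S A (planted (1/2 + b) i) (\<lambda>k. 0) F n s j M t + (\<delta> + (u - 1 - ln u) / \<delta>)"
proof -
  let ?V = "payoff S A (\<lambda>k. coin (1/2)) (\<lambda>k. if k = i then - \<kappa> else 0) F"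
  let ?W = "payoff S A (planted (1/2 + b) i) (\<lambda>k. 0) F"
  \<comment> \<open>The claim at a frozen configuration. For \<open>u\<close> at most 1 it is the
    entropy bound, as \<open>F\<close> is at most 1; for larger \<open>u\<close> the nonnegative
    potential suffices.\<close>
  have stop: "F M t \<le> u * F M t + (\<delta> + (u - 1 - ln u) / \<delta>)" if u: "0 < u" for M t u
  proof -
    have "(1 - u) * F M t \<le> max 0 (1 - u)"
      using F[of M t] by (cases "u \<le> 1") (auto simp: mult_left_le mult_nonpos_nonneg)
    moreover have "0 \<le> \<delta> + (u - 1 - ln u) / \<delta>"
      using \<delta> ln_le_minus_one[OF u] by (intro add_nonneg_nonneg divide_nonneg_pos) auto
    ultimately show ?thesis
      using one_minus_le_entropy[OF u \<delta>] by (simp add: algebra_simps)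
  qed
  \<comment> \<open>Thus \<open>\<kappa>\<close> is the relative entropy of the fair coin with
    respect to the biased one, divided by \<open>\<delta>\<close>.\<close>
  have lnb: "ln (1 + 2 * b) + ln (1 - 2 * b) = - 2 * \<delta> * \<kappa>"
  proof -
    have "ln (1 + 2 * b) + ln (1 - 2 * b) = ln ((1 + 2 * b) * (1 - 2 * b))"
      using b by (subst ln_mult) auto
    also have "(1 + 2 * b) * (1 - 2 * b) = 1 - 4 * b\<^sup>2"
      by (simp add: power2_eq_square algebra_simps)
    finally show ?thesis using \<delta> by (simp add: \<kappa>)
  qed
  show ?thesis using u
  proof (induction n arbitrary: s j M t u)
    case 0
    then show ?case using stop by simp
  next
    case (Suc n)
    let ?after_V = "after A (\<lambda>k. coin (1/2)) (\<lambda>k. if k = i then - \<kappa> else 0) (?V n) s j M t"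
    let ?after_W = "after A (planted (1/2 + b) i) (\<lambda>k. 0) (?W n) s j M t"
    have "?after_V d \<le> u * ?after_W d + (\<delta> + (u - 1 - ln u) / \<delta>)" for d
    proof (cases d)
      case (Read M')
      then show ?thesis using Suc by (simp add: after_def)
    next
      case (Pull k)
      define v where "v = (\<lambda>x. ?V n (update A s d x) j M (Suc t))"
      define w where "w = (\<lambda>x. ?W n (update A s d x) j M (Suc t))"
      have vw: "v x \<le> u' * w x + (\<delta> + (u' - 1 - ln u') / \<delta>)" if "0 < u'" for x u'
        unfolding v_def w_def using Suc.IH[OF that] .
      show ?thesis
      proof (cases "k = i")
        case False
        have V: "?after_V d = v 1 / 2 + v 0 / 2"
          using False by (simp add: after_def Pull expectation_coin v_def)
        have W: "?after_W d = w 1 / 2 + w 0 / 2"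
          using False by (simp add: after_def Pull planted_def expectation_coin w_def)
        show ?thesis
          using vw[OF Suc.prems, of 0] vw[OF Suc.prems, of 1]
          unfolding V W by (simp add: algebra_simps)
      next
        case True
        have V: "?after_V d = - \<kappa> + v 1 / 2 + v 0 / 2"
          using True by (simp add: after_def Pull expectation_coin v_def)
        have W: "?after_W d = (1/2 + b) * w 1 + (1/2 - b) * w 0"
          using True b by (simp add: after_def Pull planted_def expectation_coin w_def)
        define L1 where "L1 = ln (1 + 2 * b)"
        define L0 where "L0 = ln (1 - 2 * b)"
        have l: "ln (u * (1 + 2 * b)) = ln u + L1" "ln (u * (1 - 2 * b)) = ln u + L0"
          using b Suc.prems by (auto simp: ln_mult L1_def L0_def)
        define P where "P = (u - 1 - ln u) / \<delta>"
        define P1 where "P1 = (u * (1 + 2 * b) - 1 - (ln u + L1)) / \<delta>"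
        define P0 where "P0 = (u * (1 - 2 * b) - 1 - (ln u + L0)) / \<delta>"
        \<comment> \<open>A reward 1 multiplies the likelihood ratio by \<open>1 + 2 * b\<close>, a
          reward 0 by \<open>1 - 2 * b\<close>. The induction hypothesis is applied at the updated
          ratio, hence the generalisation over \<open>u\<close>.\<close>
        have "v 1 \<le> u * (1 + 2 * b) * w 1 + (\<delta> + P1)"
          using vw[of "u * (1 + 2 * b)" 1] b Suc.prems by (simp add: l P1_def)
        moreover have "v 0 \<le> u * (1 - 2 * b) * w 0 + (\<delta> + P0)"
          using vw[of "u * (1 - 2 * b)" 0] b Suc.prems by (simp add: l P0_def)
        \<comment> \<open>The ratio is a martingale under fair coins, so only the logarithms drift;
          the charge \<open>- \<kappa>\<close> for the pull cancels the average drift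
          exactly.\<close>
        moreover have "P1 + P0 = 2 * P + 2 * \<kappa>"
        proof -
          have L0_eq: "L0 = - 2 * \<delta> * \<kappa> - L1" using lnb by (simp add: L1_def L0_def)
          show ?thesis unfolding P_def P1_def P0_def L0_eq using \<delta> by (simp add: field_simps)
        qed
        ultimately have "- \<kappa> + v 1 / 2 + v 0 / 2 \<le> u * ((1/2 + b) * w 1 + (1/2 - b) * w 0) + (\<delta> + P)"
          by (simp add: algebra_simps)
        then show ?thesis unfolding V W P_def .
      qed
    qed
    then have "measure_pmf.expectation (decide A s j M t) ?after_V
        \<le> u * measure_pmf.expectation (decide A s j M t) ?after_W + (\<delta> + (u - 1 - ln u) / \<delta>)"
      using F by (intro expectation_after_le[where G = "\<bar>\<kappa>\<bar>" and B = 1 and G' = 0 and B' = 1]) auto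
    then show ?case using stop[OF Suc.prems] by simp
  qed
qed


section \<open>Admissible runs\<close>

lemma admissible_config_read:
  assumes "admissible_config m K j M" "legal_decision m K j M (Read M')"
  shows "j < K" "admissible_config m K (Suc j) (insert j M')"
proof -
  have M: "j < K" "M' \<subseteq> M" "card M' + 1 \<le> m" "M \<subseteq> {..<j}"
    using assms by (auto simp: admissible_config_def legal_decision_def)
  then have "finite M'" by (meson finite_lessThan finite_subset)
  then have "card (insert j M') \<le> m" using M card_insert_le_m1 by (simp add: card_insert_if)
  then show "j < K" "admissible_config m K (Suc j) (insert j M')"
    using M by (auto simp: admissible_config_def)
qed

lemma admissible_config_pull:
  assumes "admissible_config m K j M" "legal_decision m K j M (Pull k)"
  shows "k \<in> M" "k < j"
  using assms by (auto simp: admissible_config_def legal_decision_def)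

text \<open>While the planted arm \<open>l\<close> has not arrived, the run cannot be distinguished from the one on
  fair coins only, and every pull costs \<open>1/2\<close>.\<close>

lemma payoff_planted_late:
  assumes A: "streaming_alg m K A" and adm: "admissible_config m K j M" and l: "h \<le> l"
  shows "payoff (\<lambda>j t. T \<le> t \<or> h < j) A (\<lambda>k. coin (1/2)) (\<lambda>k. 1) (\<lambda>M t. 0) n s j M t
    \<le> 2 * payoff (\<lambda>j t. T \<le> t) A (planted 1 l) (\<lambda>k. if k = l then 0 else 1/2) (\<lambda>M t. 0) n s j M t"
  (is "?V n s j M t \<le> 2 * ?W n s j M t")
  using adm
proof (induction n arbitrary: s j M t)
  case (Suc n)
  show ?case
  proof (cases "T \<le> t \<or> h < j")
    case True
    have "0 \<le> ?W (Suc n) s j M t" by (rule payoff_ge_0) auto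
    then show ?thesis using True by auto
  next
    case False
    let ?after_V = "after A (\<lambda>k. coin (1/2)) (\<lambda>k. 1) (?V n) s j M t"
    let ?after_W = "after A (planted 1 l) (\<lambda>k. if k = l then 0 else 1/2) (?W n) s j M t"
    have "?after_V d \<le> 2 * ?after_W d + 0" if "d \<in> set_pmf (decide A s j M t)" for d
    proof -
      have legal: "legal_decision m K j M d"
        using A Suc.prems that by (auto simp: streaming_alg_def)
      show ?thesis
      proof (cases d)
        case (Pull k)
        \<comment> \<open>Before freezing, a stored arm satisfies
          \<open>k < j \<le> h \<le> l\<close>, so it is a fair coin in both runs and costs 1
          against 1/2.\<close>
        have "k \<noteq> l" using admissible_config_pull[of m K j M k] legal Suc.prems False l Pull by auto
        then show ?thesis
          using Suc.IH[OF Suc.prems, of "update A s d 1" "Suc t"]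
            Suc.IH[OF Suc.prems, of "update A s d 0" "Suc t"]
          by (simp add: after_def Pull planted_def expectation_coin)
      next
        case (Read M')
        then show ?thesis
          using Suc.IH[OF admissible_config_read(2)[of m K j M M']] legal Suc.prems
          by (simp add: after_def)
      qed
    qed
    then have "measure_pmf.expectation (decide A s j M t) ?after_V
        \<le> 2 * measure_pmf.expectation (decide A s j M t) ?after_W + 0"
      by (intro expectation_after_le[where G = 1 and B = 0 and G' = 1 and B' = 0]) auto
    then show ?thesis using False by simp
  qed
qed simp

text \<open>A discarded arm never returns: memory only shrinks or gains position \<open>j\<close>,
  and \<open>i < j\<close> is preserved. Hence every remaining pull costs \<open>b\<close>. The
  bound on \<open>n\<close> guarantees enough steps for all remaining pulls and reads.\<close>

lemma payoff_planted_discarded: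
  assumes A: "streaming_alg m K A" and adm: "admissible_config m K j M"
    and i: "i < j" "i \<notin> M" and t: "t \<le> T" and n: "(T - t) + (K - j) \<le> n"
    and p: "0 \<le> p" "p \<le> 1"
  shows "b * (real T - real t) \<le>
    payoff (\<lambda>j t. T \<le> t) A (planted p i) (\<lambda>k. if k = i then 0 else b) (\<lambda>M t. 0) n s j M t"
  using adm i t n
proof (induction n arbitrary: s j M t)
  case (Suc n)
  let ?g = "\<lambda>k. if k = i then 0 else b"
  let ?W = "payoff (\<lambda>j t. T \<le> t) A (planted p i) ?g (\<lambda>M t. 0)"
  show ?case
  proof (cases "T \<le> t")
    case False
    let ?after_W = "after A (planted p i) ?g (?W n) s j M t"
    have "b * (real T - real t) \<le> ?after_W d" if "d \<in> set_pmf (decide A s j M t)" for d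
    proof -
      have legal: "legal_decision m K j M d"
        using A Suc.prems(1) that by (auto simp: streaming_alg_def)
      show ?thesis
      proof (cases d)
        case (Pull k)
        have "k \<noteq> i" using admissible_config_pull[of m K j M k] legal Suc.prems Pull by auto
        moreover have "b * (real T - real (Suc t)) \<le> ?W n (update A s d x) j M (Suc t)" for x
          using Suc.prems False by (intro Suc.IH) auto
        from this[of 1] this[of 0]
        have "b * (real T - real t) \<le> b + (?W n (update A s d 1) j M (Suc t) / 2
            + ?W n (update A s d 0) j M (Suc t) / 2)"
          by (simp add: algebra_simps)
        ultimately show ?thesis
          by (simp add: after_def Pull planted_def expectation_coin)
      next
        case (Read M')
        have "b * (real T - real t) \<le> ?W n (update A s d 0) (Suc j) (insert j M') t"
          using Suc.prems legal Read admissible_config_read[of m K j M M']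
          by (intro Suc.IH) (auto simp: legal_decision_def)
        then show ?thesis by (simp add: after_def Read)
      qed
    qed
    moreover have "integrable (measure_pmf (decide A s j M t)) ?after_W"
      by (rule integrable_after_payoff[where G = "\<bar>b\<bar>" and B = 0]) auto
    ultimately have "b * (real T - real t) \<le> measure_pmf.expectation (decide A s j M t) ?after_W"
      by (intro measure_pmf.integral_ge_const) (auto simp: AE_measure_pmf_iff)
    then show ?thesis using False by simp
  qed (use Suc.prems in auto)
next
  case (0 s j M t)
  then have "t = T" by simp
  then show ?case by simp
qed

text \<open>A terminal reward, evaluated when the run freezes. If arm \<open>i\<close> has been read
  by then, it marks that the arm is lost for good while at least half of the pulls remain.\<close>

definition missed :: "nat \<Rightarrow> nat \<Rightarrow> nat set \<Rightarrow> nat \<Rightarrow> real" where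
  "missed T i M t = of_bool (i \<notin> M \<and> 2 * t \<le> T)"

lemma missed_bounds: "0 \<le> missed T i M t" "missed T i M t \<le> 1" "\<bar>missed T i M t\<bar> \<le> 1"
  by (auto simp: missed_def)

text \<open>If \<open>missed\<close> holds once the first \<open>h\<close> arms have passed, the
  remaining pulls, at least \<open>T/2\<close> of them, cost \<open>b\<close> each; the factor
  \<open>2 / (b * T)\<close> normalises this loss to 1. Costs before that moment are nonnegative and
  dropped.\<close>

lemma payoff_planted_early:
  assumes A: "streaming_alg m K A" and adm: "admissible_config m K j M"
    and i: "i < h" and n: "(T - t) + (K - j) \<le> n" and T: "0 < T"
    and p: "0 \<le> p" "p \<le> 1" and b: "0 < b"
  shows "payoff (\<lambda>j t. T \<le> t \<or> h < j) A (planted p i) (\<lambda>k. 0) (missed T i) n s j M t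
    \<le> 2 / (b * T) *
      payoff (\<lambda>j t. T \<le> t) A (planted p i) (\<lambda>k. if k = i then 0 else b) (\<lambda>M t. 0) n s j M t"
  using adm n
proof (induction n arbitrary: s j M t)
  case 0
  then show ?case using T by (simp add: missed_def)
next
  case (Suc n)
  let ?V = "payoff (\<lambda>j t. T \<le> t \<or> h < j) A (planted p i) (\<lambda>k. 0) (missed T i)"
  let ?g = "\<lambda>k. if k = i then 0 else b"
  let ?W = "payoff (\<lambda>j t. T \<le> t) A (planted p i) ?g (\<lambda>M t. 0)"
  have W0: "0 \<le> ?W n s j M t" for n s j M t
    by (rule payoff_ge_0) (use b in auto)
  \<comment> \<open>Pulls exhausted, where \<open>missed\<close> vanishes since \<open>T\<close> is
    positive; frozen because arm \<open>h\<close> has been read, so \<open>i\<close> has arrived; or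
    still in the first part of the stream.\<close>
  consider "T \<le> t" | "t < T" "h < j" | "t < T" "j \<le> h" by linarith
  then show ?case
  proof cases
    case 1
    then show ?thesis using T by (simp add: missed_def)
  next
    case 2
    have "missed T i M t \<le> 2 / (b * T) * ?W (Suc n) s j M t"
    proof (cases "i \<notin> M \<and> 2 * t \<le> T")
      case True
      have "b * (real T - real t) \<le> ?W (Suc n) s j M t"
        using Suc.prems 2 i True p by (intro payoff_planted_discarded[OF A]) auto
      moreover have "b * (real T / 2) \<le> b * (real T - real t)"
        using True b by (intro mult_left_mono) auto
      ultimately have "b * (real T / 2) \<le> ?W (Suc n) s j M t" by linarith
      then have "2 / (b * T) * (b * (real T / 2)) \<le> 2 / (b * T) * ?W (Suc n) s j M t"
        using b by (intro mult_left_mono) auto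
      then show ?thesis using True b T by (simp add: missed_def)
    next
      case False
      have "0 \<le> 2 / (b * T) * ?W (Suc n) s j M t"
        by (rule mult_nonneg_nonneg[OF _ W0]) (use b in simp)
      moreover have "missed T i M t = 0" using False by (simp add: missed_def)
      ultimately show ?thesis by (simp only:)
    qed
    then show ?thesis using 2 by simp
  next
    case 3
    let ?after_V = "after A (planted p i) (\<lambda>k. 0) (?V n) s j M t"
    let ?after_W = "after A (planted p i) ?g (?W n) s j M t"
    have "?after_V d \<le> 2 / (b * T) * ?after_W d + 0" if "d \<in> set_pmf (decide A s j M t)" for d
    proof -
      have legal: "legal_decision m K j M d"
        using A Suc.prems(1) that by (auto simp: streaming_alg_def)
      show ?thesis
      proof (cases d)
        case (Pull k)
        let ?c = "2 / (b * real T)"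
        define q where "q = (if k = i then p else 1/2)"
        have q: "0 \<le> q" "0 \<le> 1 - q" "q \<le> 1" using p by (auto simp: q_def)
        define v where "v = (\<lambda>x. ?V n (update A s d x) j M (Suc t))"
        define w where "w = (\<lambda>x. ?W n (update A s d x) j M (Suc t))"
        have vw: "v x \<le> ?c * w x" for x
          unfolding v_def w_def using Suc.prems 3 by (intro Suc.IH) auto
        have "q * v 1 + (1 - q) * v 0 \<le> q * (?c * w 1) + (1 - q) * (?c * w 0)"
          using q vw by (intro add_mono mult_left_mono)
        also have "\<dots> = ?c * (q * w 1 + (1 - q) * w 0)" by (simp only: algebra_simps)
        also have "\<dots> \<le> ?c * (?g k + (q * w 1 + (1 - q) * w 0))"
          using b by (intro mult_left_mono) auto
        also have "?g k + (q * w 1 + (1 - q) * w 0) = ?after_W d"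
          using q by (simp add: after_def Pull planted_def expectation_coin w_def flip: q_def)
        also have "q * v 1 + (1 - q) * v 0 = ?after_V d"
          using q by (simp add: after_def Pull planted_def expectation_coin v_def flip: q_def)
        finally show ?thesis by simp
      next
        case (Read M')
        have "?V n (update A s d 0) (Suc j) (insert j M') t
            \<le> 2 / (b * T) * ?W n (update A s d 0) (Suc j) (insert j M') t"
          using Suc.prems legal Read admissible_config_read[of m K j M M']
          by (intro Suc.IH) auto
        then show ?thesis by (simp add: after_def Read)
      qed
    qed
    then have "measure_pmf.expectation (decide A s j M t) ?after_V
        \<le> 2 / (b * T) * measure_pmf.expectation (decide A s j M t) ?after_W + 0"
      by (intro expectation_after_le[where G = 0 and B = 1 and G' = b and B' = 0])
         (use b in \<open>auto simp: missed_bounds\<close>)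
    then show ?thesis using 3 by simp
  qed
qed

text \<open>At most \<open>m\<close> of the first \<open>h\<close> arms are stored. Once more than
  half of the pulls are spent, the last term alone exceeds \<open>h\<close>. Being linear in
  \<open>t\<close>, that term can later be charged pull by pull.\<close>

lemma sum_missed_ge:
  assumes "card M \<le> m" "finite M" "0 < T"
  shows "real h - real m \<le> (\<Sum>i<h. missed T i M t) + 2 * real h * real t / real T"
proof (cases "2 * t \<le> T")
  case True
  have "h \<le> card ({..<h} - M) + m"
    using diff_card_le_card_Diff[OF assms(2), of "{..<h}"] assms(1) by simp
  moreover have "(\<Sum>i<h. missed T i M t) = real (card ({..<h} - M))"
    using True by (simp add: missed_def sum.If_cases of_bool_def Diff_eq Compl_eq)
  moreover have "0 \<le> 2 * real h * real t / real T" by simp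
  ultimately show ?thesis by linarith
next
  case False
  then have "real T \<le> 2 * real t" by linarith
  then have "real h * real T \<le> 2 * real h * real t"
    by (metis mult.assoc mult.commute mult_left_mono of_nat_0_le_iff)
  then have "real h \<le> 2 * real h * real t / real T" using assms(3) by (simp add: pos_le_divide_eq)
  moreover have "0 \<le> (\<Sum>i<h. missed T i M t)" by (intro sum_nonneg missed_bounds)
  ultimately show ?thesis by linarith
qed

text \<open>Each pull raises the correction by \<open>2 * h / T\<close>, which becomes part of its
  cost, and \<open>g\<close> is at least \<open>- \<kappa>\<close>. The lower bound then depends on
  the run only through its number of pulls.\<close>

lemma payoff_sum_missed_ge:
  assumes A: "streaming_alg m K A" and adm: "admissible_config m K j M" and T: "0 < T"
    and g: "\<And>k. \<bar>g k\<bar> \<le> \<kappa>"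
  shows "payoff S A a (\<lambda>k. - (\<kappa> + 2 * real h / real T)) (\<lambda>M t. 0) n s j M t
    \<le> payoff S A a g (\<lambda>M t. \<Sum>i<h. missed T i M t) n s j M t
      + (2 * real h * real t / real T - (real h - real m))"
  (is "?V n s j M t \<le> ?W n s j M t + _")
  using adm
proof (induction n arbitrary: s j M t)
  case (0 s j M t)
  have "card M \<le> m" "finite M"
    using 0 by (auto simp: admissible_config_def intro: finite_subset)
  then show ?case using sum_missed_ge[of M m T h t] T by simp
next
  case (Suc n)
  have bW: "\<bar>\<Sum>i<h. missed T i M t\<bar> \<le> real h" for M t
    using sum_bounded_above[of "{..<h}" "\<lambda>i. missed T i M t" 1] sum_nonneg[of "{..<h}" "\<lambda>i. missed T i M t"]
    by (simp add: missed_bounds)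
  show ?case
  proof (cases "S j t")
    case True
    have "card M \<le> m" "finite M"
      using Suc.prems by (auto simp: admissible_config_def intro: finite_subset)
    then show ?thesis using sum_missed_ge[of M m T h t] T True by simp
  next
    case False
    let ?v = "2 * real h * real t / real T - (real h - real m)"
    let ?c = "\<kappa> + 2 * real h / real T"
    let ?after_V = "after A a (\<lambda>k. - ?c) (?V n) s j M t"
    let ?after_W = "after A a g (?W n) s j M t"
    have "?after_V d \<le> 1 * ?after_W d + ?v" if "d \<in> set_pmf (decide A s j M t)" for d
    proof -
      have legal: "legal_decision m K j M d"
        using A Suc.prems that by (auto simp: streaming_alg_def)
      show ?thesis
      proof (cases d)
        case (Pull k)
        define v where "v = (\<lambda>x. ?V n (update A s d x) j M (Suc t))"
        define w where "w = (\<lambda>x. ?W n (update A s d x) j M (Suc t))"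
        have iv: "integrable (measure_pmf (a k)) v"
          unfolding v_def
          by (rule integrable_pmf_bounded, rule abs_payoff_le[where G = "\<bar>?c\<bar>" and B = 0]) auto
        have iw: "integrable (measure_pmf (a k)) w"
          unfolding w_def
          by (rule integrable_pmf_bounded, rule abs_payoff_le[where G = \<kappa> and B = "real h"])
             (use g bW in auto)
        have "v x \<le> w x + (?v + 2 * real h / real T)" for x
          using Suc.IH[OF Suc.prems, of "update A s d x" "Suc t"]
          by (simp add: v_def w_def field_simps add_divide_distrib)
        then have "measure_pmf.expectation (a k) v
            \<le> measure_pmf.expectation (a k) (\<lambda>x. w x + (?v + 2 * real h / real T))"
          using iv iw by (intro integral_mono) auto
        also have "\<dots> = measure_pmf.expectation (a k) w + (?v + 2 * real h / real T)"
          using iw by simp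
        finally show ?thesis
          using g[of k] by (simp add: after_def Pull v_def w_def)
      next
        case (Read M')
        then show ?thesis
          using Suc.IH[OF admissible_config_read(2)[of m K j M M'], of "update A s d 0" t] legal Suc.prems
          by (simp add: after_def)
      qed
    qed
    then have "measure_pmf.expectation (decide A s j M t) ?after_V
        \<le> 1 * measure_pmf.expectation (decide A s j M t) ?after_W + ?v"
      using g bW by (intro expectation_after_le[where G = "\<bar>?c\<bar>" and B = 0 and G' = \<kappa> and B' = "real h"]) auto
    then show ?thesis using False by simp
  qed
qed


section \<open>The lower bound\<close>

text \<open>Both halves of the argument are expressed through \<open>X\<close>. The first condition
  in \<open>small\<close> makes the gain \<open>X / 2\<close> from each late position outweigh the
  loss in \<open>X\<close> from the early ones.\<close>

lemma regret_sum_planted_ge: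
  fixes b :: real
  assumes A: "streaming_alg m K A" and K: "0 < K" "K \<le> T" and h: "h \<le> K" and b: "0 < b" "b < 1/2"
    and small: "16 * (b ^ 3 * real T) + b * real h \<le> real (K - h) / 2" "8 * b\<^sup>2 \<le> 1"
  shows "b * real T / 2 * (7/8 * real h - real m)
    \<le> (\<Sum>i<K. expected_regret K T (planted 1 i) A + expected_regret K T (planted (1/2 + b) i) A)"
proof -
  define N where "N = T + K"
  \<comment> \<open>The change of measure is used with \<open>\<delta> = 1/8\<close>, whose total
    over \<open>h\<close> positions turns \<open>h\<close> into \<open>7/8 * h\<close>.\<close>
  define \<kappa> where "\<kappa> = - ln (1 - 4 * b\<^sup>2) / (2 * (1/8))"
  define c where "c = \<kappa> + 2 * real h / real T"
  define S where "S = (\<lambda>j t. T \<le> t \<or> h < j)"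
  define X where "X = payoff S A (\<lambda>k. coin (1/2)) (\<lambda>k. 1) (\<lambda>M t. 0) N (fst A) 0 {} 0"
  define Y where "Y = (\<lambda>i. payoff S A (planted (1/2 + b) i) (\<lambda>k. 0) (missed T i) N (fst A) 0 {} 0)"
  define Z where "Z = (\<lambda>i. payoff S A (\<lambda>k. coin (1/2)) (\<lambda>k. if k = i then - \<kappa> else 0) (missed T i) N (fst A) 0 {} 0)"
  define R where "R = (\<lambda>p i. expected_regret K T (planted p i) A)"
  have T: "0 < T" using K by simp
  have adm: "admissible_config m K 0 {}" by (simp add: admissible_config_def)
  have X0: "0 \<le> X" unfolding X_def by (rule payoff_ge_0) auto
  have \<kappa>: "0 \<le> \<kappa>" "\<kappa> \<le> 32 * b\<^sup>2"
  proof -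
    have x: "0 < 1 - 4 * b\<^sup>2" "4 * b\<^sup>2 \<le> 1/2" using small by auto
    have "- ln (1 - 4 * b\<^sup>2) = ln (1 / (1 - 4 * b\<^sup>2))" using x by (simp add: ln_div)
    also have "\<dots> \<le> 1 / (1 - 4 * b\<^sup>2) - 1" using x by (intro ln_le_minus_one) auto
    also have "\<dots> = 4 * b\<^sup>2 / (1 - 4 * b\<^sup>2)" using x by (simp add: field_simps)
    also have "\<dots> \<le> 4 * b\<^sup>2 / (1/2)" using x by (intro divide_left_mono) auto
    finally show "\<kappa> \<le> 32 * b\<^sup>2" by (simp add: \<kappa>_def)
    have "ln (1 - 4 * b\<^sup>2) \<le> 0" using x by (simp add: ln_le_zero_iff)
    then show "0 \<le> \<kappa>" by (simp add: \<kappa>_def)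
  qed
  have R0: "0 \<le> R p i" if "i < K" "1/2 \<le> p" "p \<le> 1" for p i
    using that by (simp add: R_def expected_regret_planted payoff_ge_0)
  have late: "X / 2 \<le> R 1 i" if "i < K" "h \<le> i" for i
    using payoff_planted_late[OF A adm, of h i T N "fst A" 0] expected_regret_planted[of i K 1 T A] that
    by (simp add: R_def X_def N_def S_def cong: if_cong)
  have early: "b * real T / 2 * Y i \<le> R (1/2 + b) i" if i: "i < h" for i
  proof -
    have "Y i \<le> 2 / (b * T) * R (1/2 + b) i"
      using payoff_planted_early[OF A adm i, of T 0 N "1/2 + b" b "fst A"] T b i h
      by (simp add: R_def expected_regret_planted Y_def N_def S_def cong: if_cong)
    then show ?thesis using b T by (simp add: field_simps)
  qed
  \<comment> \<open>The likelihood ratio starts at \<open>u = 1\<close>, where the potential is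
    zero.\<close>
  have ZY: "Z i \<le> Y i + 1/8" for i
    using payoff_change_of_measure[of "missed T i" b "1/8" 1 \<kappa> S A i N "fst A" 0 "{}" 0] b
    by (simp add: missed_bounds \<kappa>_def Z_def Y_def)
  have "- c * X + (real h - real m) \<le> (\<Sum>i<h. Z i)"
  proof -
    have "(\<Sum>i<h. Z i) = payoff S A (\<lambda>k. coin (1/2)) (\<lambda>k. \<Sum>i<h. if k = i then - \<kappa> else 0)
        (\<lambda>M t. \<Sum>i<h. missed T i M t) N (fst A) 0 {} 0"
      unfolding Z_def by (rule payoff_sum[where G = \<kappa> and B = 1]) (use \<kappa> in \<open>auto simp: missed_bounds\<close>)
    moreover have "- c * X = payoff S A (\<lambda>k. coin (1/2))
        (\<lambda>k. - c) (\<lambda>M t. 0) N (fst A) 0 {} 0"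
      using payoff_scale[of S A "\<lambda>k. coin (1/2)" "- c" "\<lambda>k. 1" "\<lambda>M t. 0"]
      by (simp add: X_def)
    moreover have "\<bar>\<Sum>i<h. if k = i then - \<kappa> else 0\<bar> \<le> \<kappa>" for k
      using \<kappa> by (simp add: sum.delta)
    ultimately show ?thesis
      using payoff_sum_missed_ge[OF A adm T, of "\<lambda>k. \<Sum>i<h. if k = i then - \<kappa> else 0" \<kappa> S "\<lambda>k. coin (1/2)" h N "fst A" 0]
      by (simp flip: c_def)
  qed
  also have "(\<Sum>i<h. Z i) \<le> (\<Sum>i<h. Y i + 1/8)" by (intro sum_mono ZY)
  also have "\<dots> = (\<Sum>i<h. Y i) + real h / 8" by (simp add: sum.distrib)
  finally have Y: "7/8 * real h - real m - c * X \<le> (\<Sum>i<h. Y i)" by simp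
  have coeff: "b * real T / 2 * c \<le> real (K - h) / 2"
  proof -
    have "b * real T / 2 * c = b * real T / 2 * \<kappa> + b * real h"
      using T by (simp add: c_def field_simps)
    also have "\<dots> \<le> b * real T / 2 * (32 * b\<^sup>2) + b * real h"
      using \<kappa> b by (intro add_right_mono mult_left_mono) auto
    also have "\<dots> = 16 * (b ^ 3 * real T) + b * real h"
      by (simp add: power2_eq_square power3_eq_cube)
    finally show ?thesis using small by linarith
  qed
  have "b * real T / 2 * (7/8 * real h - real m)
      \<le> b * real T / 2 * (\<Sum>i<h. Y i) + b * real T / 2 * c * X"
    using mult_left_mono[OF Y, of "b * real T / 2"] b
    unfolding right_diff_distrib mult.assoc by simp
  also have "\<dots> \<le> b * real T / 2 * (\<Sum>i<h. Y i) + real (K - h) / 2 * X"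
    using mult_right_mono[OF coeff X0] by simp
  also have "b * real T / 2 * (\<Sum>i<h. Y i) = (\<Sum>i<h. b * real T / 2 * Y i)"
    by (simp add: sum_distrib_left)
  also have "\<dots> \<le> (\<Sum>i<h. R (1/2 + b) i)" by (intro sum_mono early) auto
  also have "\<dots> \<le> (\<Sum>i<K. R (1/2 + b) i)"
    using h b by (intro sum_mono2 R0) auto
  also have "real (K - h) / 2 * X = (\<Sum>i\<in>{h..<K}. X / 2)" by simp
  also have "\<dots> \<le> (\<Sum>i\<in>{h..<K}. R 1 i)" by (intro sum_mono late) auto
  also have "\<dots> \<le> (\<Sum>i<K. R 1 i)" by (intro sum_mono2 R0) auto
  finally show ?thesis by (simp add: R_def sum.distrib add.commute)
qed

section \<open>The hard distribution and its symmetry\<close>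

definition hard_instances :: "real \<Rightarrow> nat \<Rightarrow> bandit_inst pmf" where
  "hard_instances b K =
     map_pmf (\<lambda>(p, i). planted p i) (pmf_of_set ({1, 1/2 + b} \<times> {..<K}))"

lemma random_order_hard_instances:
  assumes "0 < K"
  shows "random_order K (hard_instances b K) = hard_instances b K"
proof -
  have perm: "map_pmf (\<lambda>a. a \<circ> \<sigma>) (hard_instances b K) = hard_instances b K" if \<sigma>: "\<sigma> permutes {..<K}" for \<sigma>
  proof -
    let ?U = "{1, 1/2 + b} \<times> {..<K}"
    \<comment> \<open>Reordering by \<open>\<sigma>\<close> moves the planted arm to
      \<open>inv \<sigma> i\<close>, a bijection on positions, which keeps the position
      uniform.\<close>
    have "(\<lambda>a. a \<circ> \<sigma>) \<circ> (\<lambda>(p, i). planted p i) = (\<lambda>(p, i). planted p i) \<circ> map_prod id (inv \<sigma>)"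
      by (auto simp: fun_eq_iff planted_def permutes_inverses[OF \<sigma>])
    moreover have "map_pmf (map_prod id (inv \<sigma>)) (pmf_of_set ?U) = pmf_of_set ?U"
    proof (rule map_pmf_of_set_bij_betw)
      show "bij_betw (map_prod id (inv \<sigma>)) ?U ?U"
        by (intro bij_betw_map_prod permutes_imp_bij permutes_inv \<sigma>) simp
    qed (use assms in auto)
    ultimately show ?thesis
      unfolding hard_instances_def by (metis pmf.map_comp)
  qed
  have fin: "finite {\<sigma>. \<sigma> permutes {..<K}}" "{\<sigma>. \<sigma> permutes {..<K}} \<noteq> {}"
    using permutes_id[of "{..<K}"] by (blast intro: finite_permutations)+
  have "random_order K (hard_instances b K) = bind_pmf (pmf_of_set {\<sigma>. \<sigma> permutes {..<K}})
      (\<lambda>\<sigma>. map_pmf (\<lambda>a. a \<circ> \<sigma>) (hard_instances b K))"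
    unfolding random_order_def map_pmf_def by (rule bind_commute_pmf)
  also have "\<dots> = bind_pmf (pmf_of_set {\<sigma>. \<sigma> permutes {..<K}}) (\<lambda>\<sigma>. hard_instances b K)"
    by (intro bind_pmf_cong) (use fin perm in auto)
  finally show ?thesis by simp
qed

lemma avg_regret_hard_instances:
  assumes "0 < K" "b \<noteq> 1/2"
  shows "avg_regret K T (hard_instances b K) A =
    (\<Sum>i<K. expected_regret K T (planted 1 i) A + expected_regret K T (planted (1/2 + b) i) A)
      / (2 * real K)"
proof -
  \<comment> \<open>Distinct means are what gives the support set of pairs \<open>2 * K\<close>
    elements.\<close>
  have ne: "(1::real) \<noteq> 1/2 + b" using assms by auto
  have "avg_regret K T (hard_instances b K) A =
      (\<Sum>(p, i)\<in>{1, 1/2 + b} \<times> {..<K}. expected_regret K T (planted p i) A)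
        / real (card ({1, 1/2 + b} \<times> {..<K}))"
    unfolding avg_regret_def hard_instances_def using assms
    by (simp add: integral_pmf_of_set case_prod_unfold del: card_cartesian_product) (subst integral_pmf_of_set; auto)
  also have "card ({1, 1/2 + b} \<times> {..<K}) = 2 * K" using ne by (simp add: card_cartesian_product)
  also have "(\<Sum>(p, i)\<in>{1, 1/2 + b} \<times> {..<K}. expected_regret K T (planted p i) A)
      = (\<Sum>p\<in>{1, 1/2 + b}. \<Sum>i<K. expected_regret K T (planted p i) A)"
    by (simp add: sum.cartesian_product)
  finally show ?thesis using ne by (simp add: sum.distrib)
qed

lemma avg_regret_hard_instances_ge:
  assumes A: "streaming_alg (K div 20) K A" and K: "20 \<le> K" "K \<le> T"
    and b: "b = (real K / real T) powr (1/3) / 8"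
  shows "1/200 * real K powr (1/3) * real T powr (2/3) \<le> avg_regret K T (hard_instances b K) A"
proof -
  define h where "h = K div 2"
  define m where "m = K div 20"
  have T: "0 < real T" "0 < real K" using K by auto
  have b0: "0 < b" using T by (simp add: b)
  have b1: "b \<le> 1/8"
    using powr_mono2[of "1/3" "real K / real T" 1] T K by (simp add: b)
  have b3: "b ^ 3 * real T = real K / 512"
  proof -
    have "((real K / real T) powr (1/3)) ^ 3 = real K / real T"
      using T by (simp add: powr_powr flip: powr_realpow)
    then show ?thesis using T by (simp add: b power_divide)
  qed
  have bT: "b * real T = real K powr (1/3) * real T powr (2/3) / 8"
  proof -
    have "real T powr (1/3) * real T powr (2/3) = real T"
      using T by (simp flip: powr_add)
    then have "real T / real T powr (1/3) = real T powr (2/3)"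
      using T by (simp add: field_simps)
    then show ?thesis using T by (simp add: b powr_divide field_simps)
  qed
  have hm: "real K \<le> 2 * real h + 1" "2 * real h \<le> real K" "20 * real m \<le> real K" "h \<le> K"
    unfolding h_def m_def by linarith+
  have bh: "b * real h \<le> 1/8 * real h" using b1 by (intro mult_right_mono) auto
  \<comment> \<open>The left side is at most \<open>K/32 + K/16\<close>, the right side at least
    \<open>K/4\<close>.\<close>
  have "16 * (b ^ 3 * real T) + b * real h \<le> real (K - h) / 2"
  proof -
    define y where "y = b * real h"
    have "16 * (real K / 512) + y \<le> (real K - real h) / 2"
      using bh hm(2) by (simp flip: y_def)
    then show ?thesis using hm(4) by (simp add: b3 y_def of_nat_diff)
  qed
  moreover have "8 * b\<^sup>2 \<le> 1" using power_mono[OF b1, of 2] b0 by (simp add: power2_eq_square)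
  ultimately have "b * real T / 2 * (7/8 * real h - real m)
    \<le> (\<Sum>i<K. expected_regret K T (planted 1 i) A + expected_regret K T (planted (1/2 + b) i) A)"
    using A K b0 b1 hm by (intro regret_sum_planted_ge) (auto simp: m_def)
  \<comment> \<open>Up to rounding of \<open>h\<close>, the bracket is at least
    \<open>(7/16 - 1/20) * K\<close>; \<open>20 \<le> K\<close> absorbs the rounding.\<close>
  moreover have "b * real T / 2 * (8/25 * real K) \<le> b * real T / 2 * (7/8 * real h - real m)"
    using b0 hm K by (intro mult_left_mono) auto
  ultimately have "b * real T / 2 * (8/25 * real K)
    \<le> (\<Sum>i<K. expected_regret K T (planted 1 i) A + expected_regret K T (planted (1/2 + b) i) A)"
    by (rule order_trans[rotated])
  then have "b * real T / 2 * (8/25 * real K) / (2 * real K)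
    \<le> (\<Sum>i<K. expected_regret K T (planted 1 i) A + expected_regret K T (planted (1/2 + b) i) A)
      / (2 * real K)"
    by (rule divide_right_mono) simp
  also have "\<dots> = avg_regret K T (hard_instances b K) A"
    using T b1 by (intro avg_regret_hard_instances[symmetric]) auto
  finally have "b * real T / 2 * (8/25 * real K) / (2 * real K) \<le> avg_regret K T (hard_instances b K) A" .
  moreover have "b * real T / 2 * (8/25 * real K) / (2 * real K) = 2/25 * (b * real T)"
    using T by simp
  moreover have "1/200 * real K powr (1/3) * real T powr (2/3) \<le> 2/25 * (b * real T)"
    by (simp add: bT)
  ultimately show ?thesis by linarith
qed

text \<open>At the start nothing is stored, so no pull is legal, and reading needs room for one arm;
  yet a decision distribution has nonempty support.\<close>

lemma not_streaming_alg_0: "\<not> streaming_alg 0 K A"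
proof
  assume A: "streaming_alg 0 K A"
  obtain d where d: "d \<in> set_pmf (fst (snd A) (fst A) 0 {} 0)"
    using set_pmf_not_empty by (meson ex_in_conv)
  have "admissible_config 0 K 0 {}" by (simp add: admissible_config_def)
  with A d have "legal_decision 0 K 0 {} d" by (auto simp: streaming_alg_def)
  then show False by (auto simp: legal_decision_def split: decision.splits)
qed

theorem theorem3p1:
  "\<exists>C::real. C > 0 \<and>
     (\<forall>T K :: nat. T \<ge> K \<longrightarrow>
        (\<exists>D :: bandit_inst pmf. (\<forall>a \<in> set_pmf D. valid_instance K a) \<and>
           (\<forall>A :: 's algorithm. streaming_alg (K div 20) K A \<longrightarrow>
              avg_regret K T D A \<ge> C * real K powr (1/3) * real T powr (2/3)
            \<and> avg_regret K T (random_order K D) A \<ge> C * real K powr (1/3) * real T powr (2/3))))"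
proof (intro exI[of _ "1/200 :: real"] conjI allI impI)
  fix T K :: nat
  assume TK: "K \<le> T"
  define b where "b = (real K / real T) powr (1/3) / 8"
  show "\<exists>D :: bandit_inst pmf. (\<forall>a \<in> set_pmf D. valid_instance K a) \<and>
           (\<forall>A :: 's algorithm. streaming_alg (K div 20) K A \<longrightarrow>
              avg_regret K T D A \<ge> 1/200 * real K powr (1/3) * real T powr (2/3)
            \<and> avg_regret K T (random_order K D) A \<ge> 1/200 * real K powr (1/3) * real T powr (2/3))"
  \<comment> \<open>For \<open>K < 20\<close> the memory \<open>K div 20\<close> is zero, so the
    claim is vacuous and any valid instance serves as witness.\<close>
  proof (cases "20 \<le> K")
    case True
    have "\<forall>a \<in> set_pmf (hard_instances b K). valid_instance K a"
      by (auto simp: hard_instances_def valid_instance_planted)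
    moreover have "random_order K (hard_instances b K) = hard_instances b K"
      using True by (intro random_order_hard_instances) simp
    ultimately show ?thesis
      using avg_regret_hard_instances_ge[OF _ True TK b_def]
      by (intro exI[of _ "hard_instances b K"]) (simp only: simp_thms ball_simps, blast)
  next
    case False
    then have "\<not> streaming_alg (K div 20) K A" for A :: "'s algorithm"
      using not_streaming_alg_0 by simp
    then show ?thesis
      by (intro exI[of _ "return_pmf (planted 1 0)"]) (simp add: valid_instance_planted del: split_paired_All)
  qed
qed simp

end
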